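(* Let $N$ be a positive integer and let $a,b,c,d$ be complex parameters for which the Wilson polynomial $W_N(z;a,b,c,d)$ is well defined and of degree $N$ in $z$. Let $\bar z_1,\dots,\bar z_N$ be its $N$ zeros, let $\bar x_s$ satisfy $\bar x_s^2=\bar z_s$ ($s=1,\dots,N$), and assume that $\bar z_1,\dots,\bar z_N$ are pairwise distinct and nonzero. Let $\underline{M}=(M_{nm})_{n,m=1}^N$ be the $N\times N$ matrix with entries $$M_{nm}=\Phi_{nm}(\bar x_1,\dots,\bar x_N)+\Phi_{nm}(-\bar x_1,\dots,-\bar x_N),$$ where for $u=(u_1,\dots,u_N)$ $$\Phi_{nn}(u)=\frac{1}{(2u_n)^2}\left\{\left[\frac{2A(u_n)}{\mathbf{i}u_n}+\mathbf{i}A'(u_n)\right]\prod_{\ell=1,\,\ell\neq n}^N\left(1-\frac{1+2\mathbf{i}u_n}{u_n^2-u_\ell^2}\right)+2A(u_n)\sum_{m=1,\,m\neq n}^N\frac{\mathbf{i}u_n-(u_n^2+u_m^2)}{(u_n^2-u_m^2)^2}\prod_{\ell=1,\,\ell\neq n,m}^N\left(1-\frac{1+2\mathbf{i}u_n}{u_n^2-u_\ell^2}\right)\right\}$$ and, for $m\neq n$, $$\Phi_{nm}(u)=-\frac{1}{(2u_n)^2}\,2A(u_n)\,\frac{\mathbf{i}u_m(1+2\mathbf{i}u_n)}{(u_n^2-u_m^2)^2}\prod_{\ell=1,\,\ell\neq n,m}^N\left(1-\frac{1+2\mathbf{i}u_n}{u_n^2-u_\ell^2}\right).$$ Then the $N$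 eigenvalues of $\underline{M}$ (counted with algebraic multiplicity) are $$m\,(2N-m+a+b+c+d-1)=m\,(2N-m+\alpha_1-1),\qquad m=1,2,\dots,N.$$
   Context: $\mathbf{i}$ is the imaginary unit. The Pochhammer symbol is $(a)_0=1$, $(a)_k=a(a+1)\cdots(a+k-1)$ for $k\ge 1$. The Wilson polynomial of degree $N$ in $z=x^2$ is $$W_N(z;a,b,c,d)=(a+b)_N(a+c)_N(a+d)_N\sum_{k=0}^N\frac{(-N)_k\,(N+a+b+c+d-1)_k\,[a;z]_k}{k!\,(a+b)_k(a+c)_k(a+d)_k},$$ where $[a;z]_0=1$ and $[a;z]_k=(a^2+z)\,[(a+1)^2+z]\cdots[(a+k-1)^2+z]$ for $k\ge1$. It is well defined by this formula when $(a+b)_N(a+c)_N(a+d)_N\neq0$, and it has degree exactly $N$ when $(N+a+b+c+d-1)_N\ne 0$. Notation: $\alpha_1=a+b+c+d$, $\alpha_2=ab+ac+ad+bc+bd+cd$, $\alpha_3=bcd+acd+abd+abc$, $\alpha_4=abcd$; $$A(x)=\alpha_4+\mathbf{i}\alpha_3x-\alpha_2x^2-\mathbf{i}\alpha_1x^3+x^4,\qquad A'(x)=\mathbf{i}\alpha_3-2\alpha_2x-3\mathbf{i}\alpha_1x^2+4x^3.$$ Empty products equal $1$ and empty sums equal $0$. *)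

theory Defs
  imports
    "HOL-Computational_Algebra.Computational_Algebra"
    "Jordan_Normal_Form.Char_Poly"
begin

text \<open>
  The symbol \<open>[a; z]\<^sub>k\<close> and the Wilson polynomial are polynomials in \<open>z = x\<^sup>2\<close> (not in \<open>x\<close>).
\<close>

definition wilson_bracket :: "complex \<Rightarrow> nat \<Rightarrow> complex poly" where
  "wilson_bracket a k = (\<Prod>j<k. [: (a + of_nat j)\<^sup>2, 1 :])"

text \<open>
  Division by zero yields zero in HOL, so this agrees with the usual Wilson polynomial only where
  \<open>(a+b)\<^sub>N (a+c)\<^sub>N (a+d)\<^sub>N \<noteq> 0\<close>.
\<close>

definition wilson_poly ::
    "nat \<Rightarrow> complex \<Rightarrow> complex \<Rightarrow> complex \<Rightarrow> complex \<Rightarrow> complex poly" where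
  "wilson_poly N a b c d =
     Polynomial.smult (pochhammer (a + b) N * pochhammer (a + c) N * pochhammer (a + d) N)
       (\<Sum>k\<le>N. Polynomial.smult
          (pochhammer (- of_nat N) k * pochhammer (of_nat N + a + b + c + d - 1) k /
            (fact k * pochhammer (a + b) k * pochhammer (a + c) k * pochhammer (a + d) k))
          (wilson_bracket a k))"

definition alpha1 :: "complex \<Rightarrow> complex \<Rightarrow> complex \<Rightarrow> complex \<Rightarrow> complex" where
  "alpha1 a b c d = a + b + c + d"

definition alpha2 :: "complex \<Rightarrow> complex \<Rightarrow> complex \<Rightarrow> complex \<Rightarrow> complex" where
  "alpha2 a b c d = a*b + a*c + a*d + b*c + b*d + c*d"

definition alpha3 :: "complex \<Rightarrow> complex \<Rightarrow> complex \<Rightarrow> complex \<Rightarrow> complex" where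
  "alpha3 a b c d = b*c*d + a*c*d + a*b*d + a*b*c"

definition alpha4 :: "complex \<Rightarrow> complex \<Rightarrow> complex \<Rightarrow> complex \<Rightarrow> complex" where
  "alpha4 a b c d = a*b*c*d"

definition A_fun :: "complex \<Rightarrow> complex \<Rightarrow> complex \<Rightarrow> complex \<Rightarrow> complex \<Rightarrow> complex" where
  "A_fun a b c d x =
     alpha4 a b c d + \<i> * alpha3 a b c d * x - alpha2 a b c d * x^2
       - \<i> * alpha1 a b c d * x^3 + x^4"

definition A_deriv :: "complex \<Rightarrow> complex \<Rightarrow> complex \<Rightarrow> complex \<Rightarrow> complex \<Rightarrow> complex" where
  "A_deriv a b c d x =
     \<i> * alpha3 a b c d - 2 * alpha2 a b c d * x - 3 * \<i> * alpha1 a b c d * x^2 + 4 * x^3"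

text \<open>
  Vectors with \<open>N\<close> components are functions \<open>u :: nat \<Rightarrow> complex\<close> used on \<open>{1..N}\<close>;
  \<open>S\<close> is the set of indices omitted from the product.
\<close>

definition shift_prod :: "nat \<Rightarrow> (nat \<Rightarrow> complex) \<Rightarrow> nat \<Rightarrow> nat set \<Rightarrow> complex" where
  "shift_prod N u n S =
     (\<Prod>l\<in>{1..N} - S. 1 - (1 + 2 * \<i> * u n) / ((u n)\<^sup>2 - (u l)\<^sup>2))"

definition Phi ::
    "nat \<Rightarrow> complex \<Rightarrow> complex \<Rightarrow> complex \<Rightarrow> complex \<Rightarrow> (nat \<Rightarrow> complex) \<Rightarrow> nat \<Rightarrow> nat \<Rightarrow> complex"
  where
  "Phi N a b c d u n m =
     (if n = m then
        1 / (2 * u n)\<^sup>2 *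
          ((2 * A_fun a b c d (u n) / (\<i> * u n) + \<i> * A_deriv a b c d (u n))
             * shift_prod N u n {n}
           + 2 * A_fun a b c d (u n) *
             (\<Sum>k\<in>{1..N} - {n}.
                (\<i> * u n - ((u n)\<^sup>2 + (u k)\<^sup>2)) / ((u n)\<^sup>2 - (u k)\<^sup>2)\<^sup>2
                * shift_prod N u n {n, k}))
      else
        - (1 / (2 * u n)\<^sup>2) * (2 * A_fun a b c d (u n)) *
          (\<i> * u m * (1 + 2 * \<i> * u n) / ((u n)\<^sup>2 - (u m)\<^sup>2)\<^sup>2)
          * shift_prod N u n {n, m})"

text \<open>Matrix indices start at 0 in the library, hence the shift by \<open>Suc\<close>.\<close>

definition M_mat ::
    "nat \<Rightarrow> complex \<Rightarrow> complex \<Rightarrow> complex \<Rightarrow> complex \<Rightarrow> (nat \<Rightarrow> complex) \<Rightarrow> complex mat" where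
  "M_mat N a b c d x =
     mat N N (\<lambda>(i, j). Phi N a b c d x (Suc i) (Suc j)
                      + Phi N a b c d (\<lambda>s. - x s) (Suc i) (Suc j))"

text \<open>
  Eigenvalues counted with algebraic multiplicity; \<^const>\<open>proots\<close> is the multiset of roots.
\<close>

definition eigenvalue_mset :: "complex mat \<Rightarrow> complex multiset" where
  "eigenvalue_mset B = proots (char_poly B)"

end

theory Submission
  imports Defs
begin

text \<open>
  Put \<open>D(x) = A(x) / (2\<i>x (2\<i>x + 1))\<close>. The Wilson difference operator
  \<open>(T p)(x) = D(x) (p((x - \<i>)\<^sup>2) - p(x\<^sup>2)) + D(-x) (p((x + \<i>)\<^sup>2) - p(x\<^sup>2))\<close>
  acts on polynomials \<open>p\<close> in \<open>z = x\<^sup>2\<close>. On the basis \<open>[a; z]\<^sub>k\<close> it is bidiagonal with eigenvalues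
  \<open>\<lambda>\<^sub>k = k (k + \<alpha>\<^sub>1 - 1)\<close> (lemma \<open>wilson_op_bracket_Suc\<close>), and the hypergeometric coefficients of
  \<open>W\<^sub>N\<close> are exactly those of an eigenvector: \<open>T W\<^sub>N = \<lambda>\<^sub>N W\<^sub>N\<close> (lemma \<open>wilson_op_wilson_poly\<close>).

  The flow \<open>\<psi>\<^sub>t = (T - \<lambda>\<^sub>N) \<psi>\<close> on monic polynomials of degree \<open>N\<close> has the monic multiple of \<open>W\<^sub>N\<close>
  as an equilibrium, and \<open>M\<close> is, up to sign, its linearisation there, written in the coordinates
  \<open>x\<^sub>n\<close> where the zeros of \<open>\<psi>\<close> are \<open>x\<^sub>n\<^sup>2\<close>. In the coordinate \<open>\<psi>\<close> the flow is already linear, so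
  \<open>M\<close> is similar to \<open>\<lambda>\<^sub>N - T\<close> on the tangent space, the polynomials of degree less than \<open>N\<close>; its
  eigenvalues are \<open>\<lambda>\<^sub>N - \<lambda>\<^bsub>N-m\<^esub> = m (2N - m + \<alpha>\<^sub>1 - 1)\<close> for \<open>m = 1, \<dots>, N\<close>.

  The proof is algebraic and does not construct the flow. With \<open>q\<^sub>m = \<Prod>\<^bsub>l \<noteq> m\<^esub> (z - z\<^sub>l)\<close>, the entries are
  \<open>M\<^sub>n\<^sub>m = (x\<^sub>m / x\<^sub>n) ((\<lambda>\<^sub>N - T) q\<^sub>m)(z\<^sub>n) / q\<^sub>n(z\<^sub>n)\<close> (lemma \<open>Phi_matrix_entry\<close>). Off the diagonal this
  comes from evaluating \<open>T ((z - z\<^sub>m) q\<^sub>m) = \<lambda>\<^sub>N (z - z\<^sub>m) q\<^sub>m\<close> at \<open>z\<^sub>n\<close>; on the diagonal both sides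
  vanish at \<open>z\<^sub>n\<close>, and the derivatives have to be compared (lemma \<open>wilson_op_at_node\<close>), which is
  how \<open>A'\<close> enters. Lagrange interpolation turns the formula for the entries into \<open>M V = V U\<close>,
  where \<open>V\<close> holds the scaled values of \<open>[a; z]\<^sub>j\<close> at the nodes and \<open>U\<close> is upper triangular with
  diagonal \<open>\<lambda>\<^sub>N - \<lambda>\<^sub>j\<close>.
\<close>

section \<open>Divided differences of polynomials\<close>

text \<open>
  The divided difference \<open>(p(u) - p(v)) / (u - v)\<close>, as a polynomial expression that makes sense
  also for \<open>u = v\<close>.
\<close>

definition divided_diff :: "'a::comm_ring_1 poly \<Rightarrow> 'a \<Rightarrow> 'a \<Rightarrow> 'a" where
  "divided_diff p u v = poly (synthetic_div p v) u"

lemma divided_diff_0 [simp]: "divided_diff 0 u v = 0"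
  by (simp add: divided_diff_def)

lemma divided_diff_pCons [simp]:
  "divided_diff (pCons r p) u v = poly p v + u * divided_diff p u v"
  by (simp add: divided_diff_def)

lemma divided_diff_correct: "(u - v) * divided_diff p u v = poly p u - poly p v"
proof (induction p)
  case (pCons r p)
  have "(u - v) * divided_diff (pCons r p) u v
      = (u - v) * poly p v + u * ((u - v) * divided_diff p u v)"
    by (simp add: algebra_simps)
  also have "\<dots> = poly (pCons r p) u - poly (pCons r p) v"
    unfolding pCons.IH by (simp add: algebra_simps)
  finally show ?case .
qed simp

lemma divided_diff_add: "divided_diff (p + q) u v = divided_diff p u v + divided_diff q u v"
  by (induction p q rule: poly_induct2) (auto simp: algebra_simps)

lemma divided_diff_smult: "divided_diff (Polynomial.smult r p) u v = r * divided_diff p u v"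
  by (induction p) (auto simp: algebra_simps)

lemma divided_diff_linear_factor:
  "divided_diff ([:- w, 1:] * q) u v = poly q u + (v - w) * divided_diff q u v"
proof -
  have "[:- w, 1:] * q = Polynomial.smult (- w) q + pCons 0 q"
    by simp
  then show ?thesis
    using divided_diff_correct[of u v q]
    by (simp only: divided_diff_add divided_diff_smult divided_diff_pCons) (simp add: algebra_simps)
qed

lemma isCont_divided_diff:
  fixes f g :: "'a::real_normed_field \<Rightarrow> 'a"
  assumes "isCont f t" "isCont g t"
  shows "isCont (\<lambda>x. divided_diff p (f x) (g x)) t"
  using assms by (induction p) (auto intro!: continuous_intros)

section \<open>The Wilson difference operator\<close>

context
  fixes a b c d :: complex
begin

lemma A_fun_factored:
  "A_fun a b c d x = (a + \<i> * x) * (b + \<i> * x) * (c + \<i> * x) * (d + \<i> * x)"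
  by (simp add: A_fun_def alpha1_def alpha2_def alpha3_def alpha4_def algebra_simps
      power2_eq_square power3_eq_cube power4_eq_xxxx)

lemma DERIV_A_fun: "(A_fun a b c d has_field_derivative A_deriv a b c d x) (at x)"
  unfolding A_fun_def A_deriv_def
  by (auto intro!: derivative_eq_intros simp: algebra_simps)

text \<open>
  The summand \<open>D(x) (p((x - \<i>)\<^sup>2) - p(x\<^sup>2))\<close> of the difference operator. Since
  \<open>(x - \<i>)\<^sup>2 - x\<^sup>2 = -(1 + 2\<i>x)\<close>, the factor \<open>1 + 2\<i>x\<close> in the denominator of \<open>D\<close> cancels against the
  divided difference. Defined in this way the operator has no exceptional points other than
  \<open>x = 0\<close>, as is needed because a node with \<open>1 + 2\<i>x = 0\<close> is not excluded.
\<close>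

definition wilson_half :: "complex poly \<Rightarrow> complex \<Rightarrow> complex" where
  "wilson_half p x = - A_fun a b c d x / (2 * \<i> * x) * divided_diff p ((x - \<i>)\<^sup>2) (x\<^sup>2)"

text \<open>
  The value of \<open>T p\<close> as a function of \<open>x\<close> rather than of \<open>z = x\<^sup>2\<close>; it is even in \<open>x\<close>.
\<close>

definition wilson_op :: "complex poly \<Rightarrow> complex \<Rightarrow> complex" where
  "wilson_op p x = wilson_half p x + wilson_half p (- x)"

text \<open>The eigenvalue of the difference operator in degree \<open>k\<close>.\<close>

definition wilson_eval :: "nat \<Rightarrow> complex" where
  "wilson_eval k = of_nat k * (of_nat k + alpha1 a b c d - 1)"

text \<open>
  The defect in the product rule \<open>wilson_op_linear_factor\<close>. At a node \<open>x\<^sub>n\<close> with \<open>q = q\<^sub>n\<close> it is,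
  up to the factor \<open>q\<^sub>n(z\<^sub>n)\<close>, the quantity \<open>A(x\<^sub>n) / (2\<i>x\<^sub>n)\<close> times the product occurring in \<open>\<Phi>\<close>.
\<close>

definition wilson_shift :: "complex poly \<Rightarrow> complex \<Rightarrow> complex" where
  "wilson_shift q x = A_fun a b c d x / (2 * \<i> * x) * poly q ((x - \<i>)\<^sup>2)"

lemma wilson_op_0 [simp]: "wilson_op 0 x = 0"
  by (simp add: wilson_op_def wilson_half_def)

lemma wilson_op_add: "wilson_op (p + q) x = wilson_op p x + wilson_op q x"
  by (simp add: wilson_op_def wilson_half_def divided_diff_add algebra_simps)

lemma wilson_op_smult: "wilson_op (Polynomial.smult r p) x = r * wilson_op p x"
  by (simp add: wilson_op_def wilson_half_def divided_diff_smult algebra_simps)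

lemma wilson_op_sum: "wilson_op (\<Sum>i\<in>I. f i) x = (\<Sum>i\<in>I. wilson_op (f i) x)"
  by (induction I rule: infinite_finite_induct) (auto simp: wilson_op_add)

lemma wilson_half_linear_factor:
  "wilson_half ([:- w, 1:] * q) x = (x\<^sup>2 - w) * wilson_half q x - wilson_shift q x"
proof -
  have "- r * (t + (v - w) * D) = (v - w) * (- r * D) - r * t" for r t v D :: complex
    by (simp add: algebra_simps)
  then show ?thesis
    unfolding wilson_half_def wilson_shift_def divided_diff_linear_factor minus_divide_left [symmetric]
    .
qed

lemma wilson_op_linear_factor:
  "wilson_op ([:- w, 1:] * q) x
     = (x\<^sup>2 - w) * wilson_op q x - (wilson_shift q x + wilson_shift q (- x))"
  unfolding wilson_op_def wilson_half_linear_factor by (simp add: algebra_simps)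

lemma isCont_wilson_op:
  assumes "x \<noteq> 0"
  shows "isCont (wilson_op p) x"
proof -
  have h: "isCont (wilson_half p) y" if "y \<noteq> 0" for y
    unfolding wilson_half_def
    by (intro continuous_intros isCont_divided_diff) (use that DERIV_A_fun DERIV_isCont in auto)
  have "isCont (\<lambda>x. wilson_half p (- x)) x"
    by (rule isCont_o2[OF _ h]) (use assms in auto)
  then show ?thesis
    unfolding wilson_op_def using h[OF assms] by (intro continuous_intros)
qed

text \<open>The double negation gives the shape that \<open>divided_diff_linear_factor\<close> expects.\<close>

lemma wilson_bracket_Suc:
  "wilson_bracket a (Suc k) = [:- (- ((a + of_nat k)\<^sup>2)), 1:] * wilson_bracket a k"
  by (simp only: wilson_bracket_def prod.lessThan_Suc mult.commute minus_minus)

lemma poly_wilson_bracket: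
  "poly (wilson_bracket a k) (x\<^sup>2) = pochhammer (a + \<i> * x) k * pochhammer (a - \<i> * x) k"
proof (induction k)
  case (Suc k)
  have "(a + of_nat k)\<^sup>2 + x\<^sup>2 = (a + \<i> * x + of_nat k) * (a - \<i> * x + of_nat k)"
    by (simp add: algebra_simps power2_eq_square)
  then show ?case
    using Suc by (simp add: wilson_bracket_Suc pochhammer_Suc del: mult_pCons_left)
qed (simp add: wilson_bracket_def)

lemma divided_diff_wilson_bracket:
  "divided_diff (wilson_bracket a (Suc k)) ((x - \<i>)\<^sup>2) (x\<^sup>2)
     = of_nat (Suc k) * pochhammer (a + 1 + \<i> * x) k * pochhammer (a - \<i> * x) k"
proof (induction k)
  case 0
  show ?case by (simp add: wilson_bracket_def)
next
  case (Suc k)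
  have u: "poly (wilson_bracket a (Suc k)) ((x - \<i>)\<^sup>2)
      = pochhammer (a + 1 + \<i> * x) k * (a + 1 + \<i> * x + of_nat k)
        * ((a - 1 - \<i> * x) * pochhammer (a - \<i> * x) k)"
    unfolding poly_wilson_bracket pochhammer_Suc[of "a + \<i> * (x - \<i>)"]
      pochhammer_rec[of "a - \<i> * (x - \<i>)"]
    by (simp add: algebra_simps)
  have v: "x\<^sup>2 - - (a + of_nat (Suc k))\<^sup>2
      = (a + 1 + \<i> * x + of_nat k) * (a + 1 - \<i> * x + of_nat k)"
    by (simp add: algebra_simps power2_eq_square)
  have "divided_diff (wilson_bracket a (Suc (Suc k))) ((x - \<i>)\<^sup>2) (x\<^sup>2)
      = pochhammer (a + 1 + \<i> * x) k * (a + 1 + \<i> * x + of_nat k)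
        * ((a - 1 - \<i> * x) * pochhammer (a - \<i> * x) k)
      + (a + 1 + \<i> * x + of_nat k) * (a + 1 - \<i> * x + of_nat k)
        * (of_nat (Suc k) * pochhammer (a + 1 + \<i> * x) k * pochhammer (a - \<i> * x) k)"
    unfolding wilson_bracket_Suc[of "Suc k"] divided_diff_linear_factor Suc u v ..
  also have "\<dots> = of_nat (Suc (Suc k)) * pochhammer (a + 1 + \<i> * x) (Suc k)
      * pochhammer (a - \<i> * x) (Suc k)"
    by (simp add: pochhammer_Suc algebra_simps)
  finally show ?case .
qed

lemma wilson_half_bracket:
  "wilson_half (wilson_bracket a (Suc k)) x
     = - of_nat (Suc k) / (2 * \<i> * x) * ((b + \<i> * x) * (c + \<i> * x) * (d + \<i> * x)
         * (a + of_nat k + \<i> * x)) * poly (wilson_bracket a k) (x\<^sup>2)"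
proof -
  have "(a + \<i> * x) * pochhammer (a + 1 + \<i> * x) k
      = pochhammer (a + \<i> * x) k * (a + of_nat k + \<i> * x)"
    using pochhammer_Suc[of "a + \<i> * x" k] pochhammer_rec[of "a + \<i> * x" k]
    by (simp add: algebra_simps)
  moreover have "A_fun a b c d x * (pochhammer (a + 1 + \<i> * x) k * pochhammer (a - \<i> * x) k)
     = (b + \<i> * x) * (c + \<i> * x) * (d + \<i> * x)
       * ((a + \<i> * x) * pochhammer (a + 1 + \<i> * x) k) * pochhammer (a - \<i> * x) k"
    unfolding A_fun_factored by (simp only: mult_ac)
  ultimately have A: "A_fun a b c d x * (pochhammer (a + 1 + \<i> * x) k * pochhammer (a - \<i> * x) k)
     = (b + \<i> * x) * (c + \<i> * x) * (d + \<i> * x)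
         * (a + of_nat k + \<i> * x) * (pochhammer (a + \<i> * x) k * pochhammer (a - \<i> * x) k)"
    by (simp only: mult_ac)
  have "wilson_half (wilson_bracket a (Suc k)) x = - of_nat (Suc k) / (2 * \<i> * x)
      * (A_fun a b c d x * (pochhammer (a + 1 + \<i> * x) k * pochhammer (a - \<i> * x) k))"
    unfolding wilson_half_def divided_diff_wilson_bracket by (simp add: mult_ac del: of_nat_Suc)
  then show ?thesis
    unfolding A poly_wilson_bracket by (simp only: mult_ac)
qed

lemma wilson_op_bracket_0: "wilson_op (wilson_bracket a 0) x = 0"
  by (simp add: wilson_op_def wilson_half_def wilson_bracket_def one_pCons)

lemma wilson_op_bracket_Suc:
  assumes "x \<noteq> 0"
  shows "wilson_op (wilson_bracket a (Suc k)) x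
    = wilson_eval (Suc k) * poly (wilson_bracket a (Suc k)) (x\<^sup>2)
      - of_nat (Suc k) * (a + b + of_nat k) * (a + c + of_nat k) * (a + d + of_nat k)
        * poly (wilson_bracket a k) (x\<^sup>2)"
proof -
  define e where "e = a + of_nat k"
  define y where "y = \<i> * x"
  define B where "B = poly (wilson_bracket a k) (x\<^sup>2)"
  have y: "y \<noteq> 0" "y\<^sup>2 = - (x\<^sup>2)"
    using assms by (auto simp: y_def power_mult_distrib)
  have "wilson_op (wilson_bracket a (Suc k)) x
      = - of_nat (Suc k) * B * ((b + y) * (c + y) * (d + y) * (e + y)
          - (b - y) * (c - y) * (d - y) * (e - y)) / (2 * y)"
  proof -
    have "- n / (2 * y) * F * B + - n / (2 * - y) * F' * B = - n * B * (F - F') / (2 * y)"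
      for n F F' :: complex
      using y(1) by (simp add: field_simps)
    note this [of "of_nat (Suc k)" "(b + y) * (c + y) * (d + y) * (e + y)"
        "(b - y) * (c - y) * (d - y) * (e - y)"]
    then show ?thesis
      unfolding wilson_op_def wilson_half_bracket
      by (simp only: y_def e_def B_def mult_minus_right add_uminus_conv_diff power2_minus mult.assoc)
  qed
  also have "(b + y) * (c + y) * (d + y) * (e + y) - (b - y) * (c - y) * (d - y) * (e - y)
      = 2 * y * ((e + b) * (e + c) * (e + d) - (b + c + d + e) * (e\<^sup>2 - y\<^sup>2))"
    by (simp add: algebra_simps power2_eq_square)
  also have "- of_nat (Suc k) * B * (2 * y * ((e + b) * (e + c) * (e + d)
        - (b + c + d + e) * (e\<^sup>2 - y\<^sup>2))) / (2 * y)
      = of_nat (Suc k) * (b + c + d + e) * ((e\<^sup>2 + x\<^sup>2) * B)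
        - of_nat (Suc k) * ((e + b) * (e + c) * (e + d)) * B"
    using y by (simp add: field_simps)
  also have "(e\<^sup>2 + x\<^sup>2) * B = poly (wilson_bracket a (Suc k)) (x\<^sup>2)"
    unfolding wilson_bracket_Suc by (simp add: B_def e_def del: mult_pCons_left)
  also have "of_nat (Suc k) * (b + c + d + e) = wilson_eval (Suc k)"
    by (simp add: wilson_eval_def alpha1_def e_def algebra_simps)
  finally show ?thesis
    by (simp add: e_def B_def algebra_simps)
qed

text \<open>
  The Wilson polynomial solves the difference equation: the two-term recurrence of its
  coefficients in the basis \<open>[a; z]\<^sub>k\<close> is the eigenvector equation for a bidiagonal operator.
\<close>

lemma wilson_op_wilson_poly:
  assumes nz: "pochhammer (a + b) N * pochhammer (a + c) N * pochhammer (a + d) N \<noteq> 0"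
    and x: "x \<noteq> 0"
  shows "wilson_op (wilson_poly N a b c d) x = wilson_eval N * poly (wilson_poly N a b c d) (x\<^sup>2)"
proof -
  define C :: "nat \<Rightarrow> complex" where "C k =
    pochhammer (- of_nat N) k * pochhammer (of_nat N + a + b + c + d - 1) k /
      (fact k * pochhammer (a + b) k * pochhammer (a + c) k * pochhammer (a + d) k)" for k
  define R where "R k = of_nat (Suc k) * (a + b + of_nat k) * (a + c + of_nat k) * (a + d + of_nat k)"
    for k
  define B where "B k = poly (wilson_bracket a k) (x\<^sup>2)" for k
  have rec: "C (Suc k) * R k = (wilson_eval k - wilson_eval N) * C k" if "k < N" for k
  proof -
    have nzk: "pochhammer (a + b) (Suc k) \<noteq> 0" "pochhammer (a + c) (Suc k) \<noteq> 0"
      "pochhammer (a + d) (Suc k) \<noteq> 0"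
      using nz pochhammer_eq_0_mono[of _ "Suc k" N] that by force+
    have e: "wilson_eval k - wilson_eval N
        = (- of_nat N + of_nat k) * (of_nat N + a + b + c + d - 1 + of_nat k)"
      by (simp add: wilson_eval_def alpha1_def algebra_simps)
    have "C (Suc k) = C k * ((- of_nat N + of_nat k) * (of_nat N + a + b + c + d - 1 + of_nat k)) / R k"
      by (simp add: C_def R_def pochhammer_Suc field_simps)
    moreover have "R k \<noteq> 0"
      using nzk unfolding R_def pochhammer_Suc by (simp del: of_nat_Suc)
    ultimately show ?thesis by (simp add: e mult.commute)
  qed
  define S where "S = (\<Sum>k\<le>N. Polynomial.smult (C k) (wilson_bracket a k))"
  have "wilson_op S x = (\<Sum>k\<le>N. C k * wilson_op (wilson_bracket a k) x)"
    by (simp add: S_def wilson_op_sum wilson_op_smult)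
  also have "\<dots> = (\<Sum>k\<le>N. C k * wilson_eval k * B k)
      - (\<Sum>k<N. C (Suc k) * R k * B k)"
  proof -
    have split: "(\<Sum>k\<le>N. f k) = f 0 + (\<Sum>k<N. f (Suc k))" for f :: "nat \<Rightarrow> complex"
      by (simp add: sum.atMost_shift)
    show ?thesis
      unfolding split wilson_op_bracket_0 wilson_op_bracket_Suc[OF x]
      by (simp add: wilson_eval_def[of 0] R_def B_def sum_subtractf[symmetric] algebra_simps)
  qed
  also have "(\<Sum>k<N. C (Suc k) * R k * B k) = (\<Sum>k<N. (wilson_eval k - wilson_eval N) * C k * B k)"
    by (intro sum.cong) (simp_all add: rec)
  also have "\<dots> = (\<Sum>k\<le>N. (wilson_eval k - wilson_eval N) * C k * B k)"
    by (simp flip: lessThan_Suc_atMost)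
  also have "(\<Sum>k\<le>N. C k * wilson_eval k * B k) - \<dots> = wilson_eval N * poly S (x\<^sup>2)"
    by (simp add: S_def poly_sum B_def sum_subtractf[symmetric] sum_distrib_left algebra_simps)
  finally have "wilson_op S x = wilson_eval N * poly S (x\<^sup>2)" .
  then show ?thesis
    unfolding wilson_poly_def S_def C_def by (simp add: wilson_op_smult)
qed


text \<open>The derivative of \<^const>\<open>wilson_shift\<close> with respect to \<open>x\<close>, for \<open>x \<noteq> 0\<close>.\<close>

definition wilson_shift_deriv :: "complex poly \<Rightarrow> complex \<Rightarrow> complex" where
  "wilson_shift_deriv q x =
     (A_deriv a b c d x / (2 * \<i> * x) - A_fun a b c d x / (2 * \<i> * x\<^sup>2)) * poly q ((x - \<i>)\<^sup>2)
       + A_fun a b c d x / (2 * \<i> * x) * (2 * (x - \<i>) * poly (pderiv q) ((x - \<i>)\<^sup>2))"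

lemma DERIV_wilson_shift:
  assumes "x \<noteq> 0"
  shows "(wilson_shift q has_field_derivative wilson_shift_deriv q x) (at x)"
proof -
  have "((\<lambda>y. 2 * \<i> * y) has_field_derivative 2 * \<i>) (at x)"
    by (rule DERIV_cmult_Id)
  note DERIV_divide[OF DERIV_A_fun this]
  moreover have "(s * (2 * j * x) - r * (2 * j)) / ((2 * j * x) * (2 * j * x))
      = s / (2 * j * x) - r / (2 * j * x\<^sup>2)" if "j \<noteq> 0" for r s j
    using assms that by (simp add: field_simps power2_eq_square)
  ultimately
  have 1: "((\<lambda>y. A_fun a b c d y / (2 * \<i> * y)) has_field_derivative
      A_deriv a b c d x / (2 * \<i> * x) - A_fun a b c d x / (2 * \<i> * x\<^sup>2)) (at x)"
    using assms by simp
  have "((\<lambda>y. (y - \<i>)\<^sup>2) has_field_derivative 2 * (x - \<i>)) (at x)"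
    by (auto intro!: derivative_eq_intros)
  from DERIV_chain2[OF poly_DERIV this]
  have 2: "((\<lambda>y. poly q ((y - \<i>)\<^sup>2)) has_field_derivative
      2 * (x - \<i>) * poly (pderiv q) ((x - \<i>)\<^sup>2)) (at x)"
    by (simp only: mult.commute)
  show ?thesis
    using DERIV_mult[OF 1 2] unfolding wilson_shift_def wilson_shift_deriv_def
    by (simp only: add.commute mult.commute)
qed

text \<open>
  Let \<open>P = (z - x\<^sup>2) q\<close> be an eigenvector of \<open>T\<close> with eigenvalue \<open>r\<close>. Then the product rule reads
  \<open>G(y) + G(-y) = (y\<^sup>2 - x\<^sup>2) (T q - r q)(y)\<close>, where \<open>G\<close> is \<^const>\<open>wilson_shift\<close> for \<open>q\<close>. Its value at
  \<open>y = x\<close> is the equilibrium condition, and its derivative there gives \<open>T q\<close> at the node.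
\<close>

lemma wilson_op_at_node:
  assumes x: "x \<noteq> 0"
    and eig: "\<And>y. y \<noteq> 0 \<Longrightarrow>
      wilson_op ([:- x\<^sup>2, 1:] * q) y = r * poly ([:- x\<^sup>2, 1:] * q) (y\<^sup>2)"
  shows wilson_shift_balance: "wilson_shift q x + wilson_shift q (- x) = 0"
    and wilson_op_eq_deriv:
      "2 * x * (wilson_op q x - r * poly q (x\<^sup>2)) = wilson_shift_deriv q x - wilson_shift_deriv q (- x)"
proof -
  define g where "g y = wilson_op q y - r * poly q (y\<^sup>2)" for y
  have G: "wilson_shift q y + wilson_shift q (- y) = (y\<^sup>2 - x\<^sup>2) * g y" if "y \<noteq> 0" for y
    using eig[OF that] unfolding wilson_op_linear_factor g_def by (simp add: algebra_simps)
  show bal: "wilson_shift q x + wilson_shift q (- x) = 0"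
    using G[OF x] by simp
  \<comment> \<open>Continuity of the cofactor is enough to differentiate the product at its zero.\<close>
  have "isCont g x"
    unfolding g_def by (intro continuous_intros isCont_wilson_op x)
  then have "((\<lambda>y. (y\<^sup>2 - x\<^sup>2) * g y) has_field_derivative 2 * x * g x) (at x)"
    unfolding CARAT_DERIV
    by (intro exI[of _ "\<lambda>y. (y + x) * g y"])
       (auto intro!: continuous_intros simp: power2_eq_square algebra_simps)
  then have 1: "((\<lambda>y. wilson_shift q y + wilson_shift q (- y)) has_field_derivative 2 * x * g x) (at x)"
    by (rule has_field_derivative_transform_within_open[where S = "- {0}"]) (use x G in auto)
  have "((\<lambda>y. wilson_shift q y + wilson_shift q (- y)) has_field_derivative
      wilson_shift_deriv q x + wilson_shift_deriv q (- x) * (- 1)) (at x)"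
    by (intro DERIV_add DERIV_wilson_shift x
        DERIV_chain2[where f = "wilson_shift q" and g = uminus] DERIV_minus DERIV_ident)
       (use x in auto)
  from DERIV_unique[OF 1 this]
  show "2 * x * (wilson_op q x - r * poly q (x\<^sup>2)) = wilson_shift_deriv q x - wilson_shift_deriv q (- x)"
    by (simp add: g_def)
qed

section \<open>The matrix entries\<close>

text \<open>
  The monic polynomial with the zeros \<open>z\<^sub>l\<close> for \<open>l \<in> J\<close>. Omitting one node gives the Lagrange basis
  polynomials up to a scalar factor.
\<close>

definition nodal :: "(nat \<Rightarrow> complex) \<Rightarrow> nat set \<Rightarrow> complex poly" where
  "nodal z J = (\<Prod>l\<in>J. [:- z l, 1:])"

lemma poly_nodal: "poly (nodal z J) y = (\<Prod>l\<in>J. y - z l)"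
  by (simp add: nodal_def poly_prod)

lemma nodal_remove: "finite J \<Longrightarrow> k \<in> J \<Longrightarrow> nodal z J = [:- z k, 1:] * nodal z (J - {k})"
  unfolding nodal_def by (rule prod.remove)

lemma poly_nodal_remove_neq_0:
  assumes "inj_on z J" "finite J" "n \<in> J"
  shows "poly (nodal z (J - {n})) (z n) \<noteq> 0"
  using assms by (auto simp: poly_nodal inj_on_def)

lemma pderiv_nodal: "pderiv (nodal z J) = (\<Sum>k\<in>J. nodal z (J - {k}))"
  unfolding nodal_def pderiv_prod by (simp add: pderiv_pCons)

text \<open>
  The products in \<open>\<Phi>\<close> are quotients of the values of a nodal polynomial at \<open>(u\<^sub>n - \<i>)\<^sup>2\<close> and \<open>u\<^sub>n\<^sup>2\<close>.
\<close>

lemma poly_nodal_shift_prod: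
  assumes "\<And>l. l \<in> {1..N} - S \<Longrightarrow> (u l)\<^sup>2 \<noteq> (u n)\<^sup>2"
  shows "poly (nodal (\<lambda>l. (u l)\<^sup>2) ({1..N} - S)) ((u n - \<i>)\<^sup>2)
    = shift_prod N u n S * poly (nodal (\<lambda>l. (u l)\<^sup>2) ({1..N} - S)) ((u n)\<^sup>2)"
proof -
  have "(u n - \<i>)\<^sup>2 - (u l)\<^sup>2
      = (1 - (1 + 2 * \<i> * u n) / ((u n)\<^sup>2 - (u l)\<^sup>2)) * ((u n)\<^sup>2 - (u l)\<^sup>2)"
    if "l \<in> {1..N} - S" for l
    using assms[OF that] by (simp add: field_simps power2_eq_square)
  then show ?thesis
    unfolding poly_nodal shift_prod_def prod.distrib[symmetric] by (rule prod.cong[OF refl])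
qed

lemma divide_2_imaginary_unit: "r / (2 * \<i> * w) = - (\<i> * r / (2 * w))" for r w :: complex
  by (cases "w = 0") (simp_all add: field_simps)

lemma Phi_offdiag:
  fixes N :: nat and u :: "nat \<Rightarrow> complex"
  defines "q \<equiv> \<lambda>m. nodal (\<lambda>l. (u l)\<^sup>2) ({1..N} - {m})"
  assumes n: "n \<in> {1..N}" and m: "m \<in> {1..N}" and "n \<noteq> m"
    and inj: "inj_on (\<lambda>l. (u l)\<^sup>2) {1..N}" and nz: "u n \<noteq> 0"
  shows "Phi N a b c d u n m = - (u m / u n) * wilson_shift (q m) (u n)
    / (((u n)\<^sup>2 - (u m)\<^sup>2) * poly (q n) ((u n)\<^sup>2))"
proof -
  define p where "p = nodal (\<lambda>l. (u l)\<^sup>2) ({1..N} - {n, m})"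
  have ne: "(u l)\<^sup>2 \<noteq> (u n)\<^sup>2" if "l \<in> {1..N} - {n}" for l
    using inj_onD[OF inj _ _ n, of l] that by auto
  have qm: "q m = [:- (u n)\<^sup>2, 1:] * p" and qn: "q n = [:- (u m)\<^sup>2, 1:] * p"
    using nodal_remove[of "{1..N} - {m}" n "\<lambda>l. (u l)\<^sup>2"] nodal_remove[of "{1..N} - {n}" m "\<lambda>l. (u l)\<^sup>2"]
      n m \<open>n \<noteq> m\<close>
    by (auto simp: q_def p_def Diff_insert2[symmetric] insert_commute)
  define P where "P = poly p ((u n)\<^sup>2)"
  have P: "P \<noteq> 0"
    using ne by (auto simp: P_def p_def poly_nodal) metis
  have y: "(u n)\<^sup>2 - (u m)\<^sup>2 \<noteq> 0"
    using ne[of m] m \<open>n \<noteq> m\<close> by auto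
  have 1: "poly (q m) ((u n - \<i>)\<^sup>2) = - (1 + 2 * \<i> * u n) * (shift_prod N u n {n, m} * P)"
    using poly_nodal_shift_prod[of N "{n, m}" u n] ne
    by (simp add: qm p_def P_def del: mult_pCons_left) (simp add: algebra_simps power2_eq_square)
  have 2: "poly (q n) ((u n)\<^sup>2) = ((u n)\<^sup>2 - (u m)\<^sup>2) * P"
    by (simp add: qn P_def del: mult_pCons_left)
  define Y where "Y = (u n)\<^sup>2 - (u m)\<^sup>2"
  have "Y \<noteq> 0" using y by (simp add: Y_def)
  have "- (1 / (2 * w)\<^sup>2) * (2 * A) * (j * v * T / Y\<^sup>2) * S
      = - (v / w) * (- (j * A / (2 * w)) * (- T * (S * P))) / (Y * (Y * P))"
    if "w \<noteq> 0" for A j T S v w :: complex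
    using that P \<open>Y \<noteq> 0\<close> by (simp add: field_simps power2_eq_square)
  from this[OF nz] show ?thesis
    unfolding Phi_def wilson_shift_def 1 2 Y_def[symmetric] divide_2_imaginary_unit
      if_not_P[OF \<open>n \<noteq> m\<close>] .
qed

text \<open>
  Besides the derivative of \<^const>\<open>wilson_shift\<close>, the diagonal terms contain a multiple of
  \<^const>\<open>wilson_shift\<close> itself. The coefficient of this multiple is even in \<open>u\<close>, so that it cancels in
  \<open>\<Phi>(x) + \<Phi>(-x)\<close> by the equilibrium condition \<open>wilson_shift_balance\<close>.
\<close>

lemma Phi_diag:
  fixes N :: nat and u :: "nat \<Rightarrow> complex"
  defines "q \<equiv> \<lambda>m. nodal (\<lambda>l. (u l)\<^sup>2) ({1..N} - {m})"
  assumes n: "n \<in> {1..N}"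
    and inj: "inj_on (\<lambda>l. (u l)\<^sup>2) {1..N}" and nz: "u n \<noteq> 0"
  shows "Phi N a b c d u n n * poly (q n) ((u n)\<^sup>2) =
    (1 / (2 * (u n)\<^sup>2) + (\<Sum>k\<in>{1..N} - {n}. 1 / ((u n)\<^sup>2 - (u k)\<^sup>2))) * wilson_shift (q n) (u n)
    - wilson_shift_deriv (q n) (u n) / (2 * u n)"
proof -
  define w where "w = u n"
  define A where "A = A_fun a b c d w"
  define A' where "A' = A_deriv a b c d w"
  define Q where "Q = poly (q n) (w\<^sup>2)"
  define y where "y k = w\<^sup>2 - (u k)\<^sup>2" for k
  define R where "R = shift_prod N u n {n}"
  define S where "S k = shift_prod N u n {n, k}" for k
  have ne: "(u l)\<^sup>2 \<noteq> (u n)\<^sup>2" if "l \<in> {1..N} - {n}" for l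
    using inj_onD[OF inj _ _ n, of l] that by auto
  have y: "y k \<noteq> 0" if "k \<in> {1..N} - {n}" for k
    using ne[OF that] by (simp add: y_def w_def)
  have w: "w \<noteq> 0" using nz by (simp add: w_def)
  have R: "R = (1 - (1 + 2 * \<i> * w) / y k) * S k" if "k \<in> {1..N} - {n}" for k
    unfolding R_def S_def shift_prod_def y_def w_def
    using prod.remove[OF _ that] by (simp add: Diff_insert2[symmetric] insert_commute)
  have q: "poly (q n) ((w - \<i>)\<^sup>2) = R * Q"
    using poly_nodal_shift_prod[of N "{n}" u n] ne by (simp add: q_def w_def Q_def R_def)
  have "poly (nodal (\<lambda>l. (u l)\<^sup>2) ({1..N} - {n} - {k})) ((w - \<i>)\<^sup>2) = S k / y k * Q"
    if k: "k \<in> {1..N} - {n}" for k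
  proof -
    have "Q = y k * poly (nodal (\<lambda>l. (u l)\<^sup>2) ({1..N} - {n, k})) (w\<^sup>2)"
      using nodal_remove[OF _ k, of "\<lambda>l. (u l)\<^sup>2"]
      by (simp add: Q_def q_def y_def Diff_insert2[symmetric] insert_commute del: mult_pCons_left)
    then show ?thesis
      using poly_nodal_shift_prod[of N "{n, k}" u n] ne y[OF k]
      by (simp add: w_def S_def Diff_insert2[symmetric] insert_commute)
  qed
  then have q': "poly (pderiv (q n)) ((w - \<i>)\<^sup>2) = (\<Sum>k\<in>{1..N} - {n}. S k / y k) * Q"
    unfolding q_def pderiv_nodal poly_sum sum_distrib_right by (rule sum.cong[OF refl])
  have summand: "1 / (2 * w\<^sup>2) * A * ((\<i> * w - (w\<^sup>2 + (u k)\<^sup>2)) / (y k)\<^sup>2 * S k)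
      = A / (2 * \<i> * w) * R * (1 / y k) - A * (w - \<i>) / (2 * \<i> * w\<^sup>2) * (S k / y k)"
    if k: "k \<in> {1..N} - {n}" for k
  proof -
    have uk: "(u k)\<^sup>2 = w\<^sup>2 - y k" by (simp add: y_def)
    \<comment> \<open>The second part of the numerator completes \<open>S k\<close> to \<open>R = (1 - (1 + 2\<i>w) / y k) * S k\<close>.\<close>
    have 1: "\<i> * w - (w\<^sup>2 + (w\<^sup>2 - y k)) = \<i> * (w - \<i>) * y k - \<i> * w * (y k - (1 + 2 * \<i> * w))"
      by (simp add: algebra_simps power2_eq_square)
    have 2: "1 / (2 * w\<^sup>2) * A * ((j * h * t - j * w * (t - T)) / t\<^sup>2 * S')
      = - (j * A / (2 * w)) * ((1 - T / t) * S') * (1 / t) - - (j * (A * h) / (2 * w\<^sup>2)) * (S' / t)"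
      if "t \<noteq> 0" for j h t T S' :: complex
      using w that by (simp add: field_simps power2_eq_square)
    show ?thesis
      unfolding uk R[OF k] 1 divide_2_imaginary_unit by (rule 2[OF y[OF k]])
  qed
  have sum: "1 / (2 * w\<^sup>2) * A * (\<Sum>k\<in>{1..N} - {n}. (\<i> * w - (w\<^sup>2 + (u k)\<^sup>2)) / (y k)\<^sup>2 * S k)
      = A / (2 * \<i> * w) * R * (\<Sum>k\<in>{1..N} - {n}. 1 / y k)
        - A * (w - \<i>) / (2 * \<i> * w\<^sup>2) * (\<Sum>k\<in>{1..N} - {n}. S k / y k)"
    unfolding sum_distrib_left sum_subtractf[symmetric] by (rule sum.cong[OF refl summand])
  have "Phi N a b c d u n n =
      1 / (2 * w)\<^sup>2 * (2 * A / (\<i> * w) + \<i> * A') * R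
      + 1 / (2 * w\<^sup>2) * A * (\<Sum>k\<in>{1..N} - {n}. (\<i> * w - (w\<^sup>2 + (u k)\<^sup>2)) / (y k)\<^sup>2 * S k)"
    by (simp add: Phi_def w_def A_def A'_def R_def S_def y_def algebra_simps power_mult_distrib)
  also note sum
  finally have Phi: "Phi N a b c d u n n = 1 / (2 * w)\<^sup>2 * (2 * (2 * A / (2 * \<i> * w)) + \<i> * A') * R
      + (A / (2 * \<i> * w) * R * (\<Sum>k\<in>{1..N} - {n}. 1 / y k)
        - A * (w - \<i>) / (2 * \<i> * w\<^sup>2) * (\<Sum>k\<in>{1..N} - {n}. S k / y k))"
    by simp
  have alg: "(1 / (2 * w)\<^sup>2 * (2 * - (j * (2 * A) / (2 * w)) + j * A') * R
      + (- (j * A / (2 * w)) * R * s - - (j * (A * h) / (2 * w\<^sup>2)) * t)) * Q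
    = (1 / (2 * w\<^sup>2) + s) * (- (j * A / (2 * w)) * (R * Q))
      - ((- (j * A' / (2 * w)) - - (j * A / (2 * w\<^sup>2))) * (R * Q)
          + - (j * A / (2 * w)) * (2 * h * (t * Q))) / (2 * w)" for j h s t :: complex
    using w by (simp add: field_simps power2_eq_square)
  show ?thesis
    unfolding wilson_shift_deriv_def wilson_shift_def w_def[symmetric] q q' Phi
      A_def[symmetric] A'_def[symmetric] Q_def[symmetric] y_def[symmetric] divide_2_imaginary_unit
    by (rule alg)
qed


text \<open>
  The matrix of \<open>r - T\<close> in the Lagrange basis, conjugated by the diagonal matrix with entries
  \<open>x\<^sub>n\<close>.
\<close>

lemma Phi_matrix_entry:
  fixes N :: nat and x :: "nat \<Rightarrow> complex"
  defines "z \<equiv> \<lambda>l. (x l)\<^sup>2"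
  defines "q \<equiv> \<lambda>m. nodal z ({1..N} - {m})"
  assumes n: "n \<in> {1..N}" and m: "m \<in> {1..N}"
    and inj: "inj_on z {1..N}" and nz: "x n \<noteq> 0"
    and eig: "\<And>y. y \<noteq> 0 \<Longrightarrow> wilson_op (nodal z {1..N}) y = r * poly (nodal z {1..N}) (y\<^sup>2)"
  shows "Phi N a b c d x n m + Phi N a b c d (\<lambda>s. - x s) n m
    = x m / x n * (r * poly (q m) (z n) - wilson_op (q m) (x n)) / poly (q n) (z n)"
proof -
  have ne: "z l \<noteq> z n" if "l \<in> {1..N} - {n}" for l
    using inj_onD[OF inj _ _ n, of l] that by auto
  have Q: "poly (q n) (z n) \<noteq> 0"
    unfolding q_def using inj n by (intro poly_nodal_remove_neq_0) simp_all
  have fac: "nodal z {1..N} = [:- z k, 1:] * q k" if "k \<in> {1..N}" for k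
    unfolding q_def by (rule nodal_remove) (use that in auto)
  have neg: "(\<lambda>l. (- x l)\<^sup>2) = z"
    by (simp add: z_def)
  show ?thesis
  proof (cases "n = m")
    case False
    have y: "z n - z m \<noteq> 0"
      using ne[of m] m False by auto
    have qm: "poly (q m) (z n) = 0"
      using n False by (auto simp: q_def poly_nodal)
    have eq: "(z n - z m) * wilson_op (q m) (x n) = wilson_shift (q m) (x n) + wilson_shift (q m) (- x n)"
      using eig[OF nz] qm unfolding fac[OF m] wilson_op_linear_factor
      by (simp add: z_def del: mult_pCons_left)
    have 1: "Phi N a b c d x n m
        = - (x m / x n) * wilson_shift (q m) (x n) / ((z n - z m) * poly (q n) (z n))"
      using Phi_offdiag[OF n m False, of x] inj nz unfolding z_def q_def by simp
    have 2: "Phi N a b c d (\<lambda>s. - x s) n m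
        = - (x m / x n) * wilson_shift (q m) (- x n) / ((z n - z m) * poly (q n) (z n))"
      using Phi_offdiag[OF n m False, of "\<lambda>s. - x s"] inj nz unfolding q_def neg by (simp add: z_def)
    have "Phi N a b c d x n m + Phi N a b c d (\<lambda>s. - x s) n m
        = - (x m / x n) * ((z n - z m) * wilson_op (q m) (x n)) / ((z n - z m) * poly (q n) (z n))"
      unfolding 1 2 eq by (simp only: add_divide_distrib[symmetric] distrib_left[symmetric])
    also have "\<dots> = x m / x n * (- wilson_op (q m) (x n)) / poly (q n) (z n)"
      using y by simp
    finally show ?thesis
      using qm by simp
  next
    case True
    have eigx: "wilson_op ([:- (x n)\<^sup>2, 1:] * q n) y = r * poly ([:- (x n)\<^sup>2, 1:] * q n) (y\<^sup>2)"
      if "y \<noteq> 0" for y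
      using eig[OF that] unfolding fac[OF n] by (simp only: z_def)
    have bal: "wilson_shift (q n) (x n) + wilson_shift (q n) (- x n) = 0"
      by (rule wilson_shift_balance[OF nz eigx])
    have deriv: "2 * x n * (wilson_op (q n) (x n) - r * poly (q n) ((x n)\<^sup>2))
        = wilson_shift_deriv (q n) (x n) - wilson_shift_deriv (q n) (- x n)"
      by (rule wilson_op_eq_deriv[OF nz eigx])
    define s where "s = 1 / (2 * z n) + (\<Sum>k\<in>{1..N} - {n}. 1 / (z n - z k))"
    have 1: "Phi N a b c d x n n * poly (q n) (z n)
        = s * wilson_shift (q n) (x n) - wilson_shift_deriv (q n) (x n) / (2 * x n)"
      using Phi_diag[OF n, of x] inj nz unfolding z_def q_def s_def by simp
    have 2: "Phi N a b c d (\<lambda>s. - x s) n n * poly (q n) (z n)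
        = s * wilson_shift (q n) (- x n) + wilson_shift_deriv (q n) (- x n) / (2 * x n)"
      using Phi_diag[OF n, of "\<lambda>s. - x s"] inj nz unfolding q_def neg s_def by (simp add: z_def)
    have "(Phi N a b c d x n n + Phi N a b c d (\<lambda>s. - x s) n n) * poly (q n) (z n)
        = s * (wilson_shift (q n) (x n) + wilson_shift (q n) (- x n))
          - (wilson_shift_deriv (q n) (x n) - wilson_shift_deriv (q n) (- x n)) / (2 * x n)"
      unfolding distrib_right 1 2 by (simp add: algebra_simps diff_divide_distrib)
    also have "\<dots> = r * poly (q n) (z n) - wilson_op (q n) (x n)"
      unfolding bal deriv[symmetric] using nz by (simp add: z_def)
    finally show ?thesis
      using True Q nz by (simp add: eq_divide_eq)
  qed
qed

end

section \<open>Triangular form and spectrum\<close>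

lemma lagrange_interpolation:
  fixes p :: "complex poly"
  assumes inj: "inj_on z J" and fin: "finite J" and deg: "degree p < card J"
  shows "p = (\<Sum>m\<in>J. Polynomial.smult (poly p (z m) / poly (nodal z (J - {m})) (z m)) (nodal z (J - {m})))"
    (is "p = ?S")
proof (rule poly_eqI_degree)
  have card: "card (z ` J) = card J"
    by (rule card_image[OF inj])
  show "degree p < card (z ` J)"
    using deg card by simp
  have pos: "0 < card J"
    using deg by simp
  have "degree (nodal z (J - {m})) < card J" if "m \<in> J" for m
  proof -
    have "degree (nodal z (J - {m})) \<le> card (J - {m})"
      unfolding nodal_def using degree_prod_sum_le[of "J - {m}" "\<lambda>l. [:- z l, 1:]"] fin by simp
    then show ?thesis
      using that fin pos by simp
  qed
  then have "degree ?S < card J"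
    by (intro degree_sum_less pos le_less_trans[OF degree_smult_le])
  then show "degree ?S < card (z ` J)"
    using card by simp
next
  fix t assume "t \<in> z ` J"
  then obtain n where n: "n \<in> J" "t = z n"
    by auto
  have 0: "poly (nodal z (J - {m})) (z n) = 0" if "m \<in> J - {n}" for m
    using that n fin by (auto simp: poly_nodal)
  show "poly p t = poly ?S t"
    unfolding poly_sum using n fin poly_nodal_remove_neq_0[OF inj]
    by (simp add: sum.remove[of _ n] 0)
qed

lemma degree_wilson_bracket: "degree (wilson_bracket a k) = k"
  unfolding wilson_bracket_def by (subst degree_prod_eq_sum_degree) auto

lemma lead_coeff_wilson_bracket: "lead_coeff (wilson_bracket a k) = 1"
  unfolding wilson_bracket_def lead_coeff_prod by simp

lemma wilson_bracket_independent:
  assumes "(\<Sum>j<n. Polynomial.smult (w j) (wilson_bracket a j)) = 0" and "j < n"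
  shows "w j = 0"
  using assms
proof (induction n)
  case (Suc n)
  let ?S = "\<Sum>j<n. Polynomial.smult (w j) (wilson_bracket a j)"
  have "coeff ?S n = 0"
    unfolding coeff_sum by (rule sum.neutral) (auto simp: coeff_eq_0 degree_wilson_bracket)
  moreover have "coeff (wilson_bracket a n) n = 1"
    using lead_coeff_wilson_bracket[of a n] by (simp only: degree_wilson_bracket)
  ultimately have "coeff (\<Sum>j<Suc n. Polynomial.smult (w j) (wilson_bracket a j)) n = w n"
    by simp
  then have "w n = 0"
    unfolding Suc.prems(1) by simp
  then show ?case
    using Suc by (auto simp: less_Suc_eq)
qed simp

lemma char_poly_intertwine:
  fixes B U V :: "'a::field mat"
  assumes B: "B \<in> carrier_mat n n" and U: "U \<in> carrier_mat n n" and V: "V \<in> carrier_mat n n"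
    and det: "det V \<noteq> 0" and BV: "B * V = V * U"
  shows "char_poly B = char_poly U"
proof -
  obtain V' where V': "V' \<in> carrier_mat n n" and inv: "V' * V = 1\<^sub>m n" "V * V' = 1\<^sub>m n"
    using det_non_zero_imp_unit[OF V det, of undefined] unfolding Units_def ring_mat_def by auto
  have "V * U * V' = B * (V * V')"
    unfolding BV[symmetric] by (rule assoc_mult_mat[OF B V V'])
  then have "B = V * U * V'"
    using B by (simp add: inv)
  then have "similar_mat B U"
    by (intro similar_matI[of _ _ V V' n]) (use B U V V' inv in auto)
  then show ?thesis
    by (rule char_poly_similar)
qed

lemma proots_linear_factors: "proots (\<Prod>t\<leftarrow>ts. [:- t, 1:]) = mset (ts :: 'a::idom list)"
proof (induction ts)
  case (Cons t ts)
  have "(\<Prod>t\<leftarrow>ts. [:- t, 1:]) \<noteq> 0"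
    by (auto simp: prod_list_zero_iff)
  then show ?case
    using Cons proots_mult[of "[:- t, 1:]" "\<Prod>t\<leftarrow>ts. [:- t, 1:]"] by (simp del: mult_pCons_left)
qed simp

theorem proposition2p1:
  fixes N :: nat and a b c d :: complex and z x :: "nat \<Rightarrow> complex"
  assumes "N > 0"
    and "pochhammer (a + b) N * pochhammer (a + c) N * pochhammer (a + d) N \<noteq> 0"
    and "degree (wilson_poly N a b c d) = N"
    and "proots (wilson_poly N a b c d) = image_mset z (mset_set {1..N})"
    and "\<And>s. s \<in> {1..N} \<Longrightarrow> (x s)\<^sup>2 = z s"
    and "inj_on z {1..N}"
    and "\<And>s. s \<in> {1..N} \<Longrightarrow> z s \<noteq> 0"
  shows "eigenvalue_mset (M_mat N a b c d x) =
    image_mset (\<lambda>m. of_nat m * (2 * of_nat N - of_nat m + alpha1 a b c d - 1)) (mset_set {1..N})"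
proof -
  let ?I = "{1..N}"
  let ?T = "wilson_op a b c d"
  define lam where "lam = wilson_eval a b c d"
  define W where "W = wilson_poly N a b c d"
  define w where "w = (\<lambda>s. (x s)\<^sup>2)"
  have wz: "w s = z s" if "s \<in> ?I" for s
    using assms(5)[OF that] by (simp add: w_def)
  have inj: "inj_on w ?I"
    using assms(6) wz by (metis inj_on_cong)
  have x: "x s \<noteq> 0" if "s \<in> ?I" for s
    using assms(5,7)[OF that] by auto
  define q where "q m = nodal w (?I - {m})" for m
  define Q where "Q m = poly (q m) (w m)" for m
  have Q: "Q m \<noteq> 0" if "m \<in> ?I" for m
    unfolding Q_def q_def using inj that by (intro poly_nodal_remove_neq_0) simp_all

  have W0: "lead_coeff W \<noteq> 0"
  proof -
    have "W \<noteq> 0"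
      using assms(1,3) by (auto simp: W_def)
    then show ?thesis
      by simp
  qed
  have "image_mset z (mset_set ?I) = image_mset w (mset_set ?I)"
    by (rule image_mset_cong) (simp add: wz)
  then have W: "W = Polynomial.smult (lead_coeff W) (nodal w ?I)"
    using complex_poly_decompose_multiset[of W] assms(4)
    by (simp add: W_def nodal_def prod_unfold_prod_mset image_mset.compositionality comp_def)
  have eig: "?T (nodal w ?I) y = lam N * poly (nodal w ?I) (y\<^sup>2)" if "y \<noteq> 0" for y
  proof -
    have "?T W y = lam N * poly W (y\<^sup>2)"
      unfolding W_def lam_def by (rule wilson_op_wilson_poly[OF assms(2) that])
    then have "lead_coeff W * ?T (nodal w ?I) y = lead_coeff W * (lam N * poly (nodal w ?I) (y\<^sup>2))"
      by (subst (asm) (1 2) W) (simp add: wilson_op_smult)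
    then show ?thesis
      using W0 by simp
  qed

  \<comment> \<open>\<open>M\<close> represents \<open>\<lambda>\<^sub>N - T\<close> on polynomials of degree less than \<open>N\<close>, given by their scaled
    values at the nodes.\<close>
  define M where "M n m = Phi N a b c d x n m + Phi N a b c d (\<lambda>s. - x s) n m" for n m
  have action: "(\<Sum>m\<in>?I. M n m * (poly p (w m) / (x m * Q m)))
      = (lam N * poly p (w n) - ?T p (x n)) / (x n * Q n)"
    if n: "n \<in> ?I" and p: "degree p < N" for n p
  proof -
    define r where "r m = poly p (w m) / Q m" for m
    have lagrange: "p = (\<Sum>m\<in>?I. Polynomial.smult (r m) (q m))"
      unfolding r_def Q_def q_def by (rule lagrange_interpolation[OF inj]) (use p in auto)
    have "poly p (w n) = (\<Sum>m\<in>?I. r m * poly (q m) (w n))"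
      by (subst lagrange) (simp add: poly_sum)
    moreover have "?T p (x n) = (\<Sum>m\<in>?I. r m * ?T (q m) (x n))"
      by (subst lagrange) (simp add: wilson_op_sum wilson_op_smult)
    ultimately have split: "lam N * poly p (w n) - ?T p (x n)
        = (\<Sum>m\<in>?I. r m * (lam N * poly (q m) (w n) - ?T (q m) (x n)))"
      by (simp add: sum_distrib_left sum_subtractf right_diff_distrib mult.left_commute)
    have "M n m * (poly p (w m) / (x m * Q m))
        = r m * (lam N * poly (q m) (w n) - ?T (q m) (x n)) / (x n * Q n)" if m: "m \<in> ?I" for m
    proof -
      have "M n m = x m / x n * (lam N * poly (q m) (w n) - ?T (q m) (x n)) / Q n"
        unfolding M_def Q_def q_def w_def
        by (rule Phi_matrix_entry[OF n m inj[unfolded w_def] x[OF n] eig[unfolded w_def]])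
      then show ?thesis
        using x[OF m] by (simp add: r_def mult_ac)
    qed
    then show ?thesis
      unfolding split sum_divide_distrib by (rule sum.cong[OF refl])
  qed

  \<comment> \<open>\<open>U\<close> is the matrix of \<open>\<lambda>\<^sub>N - T\<close> in the basis \<open>[a; z]\<^sub>j\<close>, and \<open>V\<close> is the change of basis.\<close>
  define R where "R k = of_nat (Suc k) * (a + b + of_nat k) * (a + c + of_nat k) * (a + d + of_nat k)"
    for k
  define U where "U = mat N N (\<lambda>(i, j). if i = j then lam N - lam j else if j = Suc i then R i else 0)"
  define v where "v n j = poly (wilson_bracket a j) (w n) / (x n * Q n)" for n j
  define V where "V = mat N N (\<lambda>(i, j). v (Suc i) j)"
  have carrier: "M_mat N a b c d x \<in> carrier_mat N N" "U \<in> carrier_mat N N" "V \<in> carrier_mat N N"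
    by (simp_all add: M_mat_def U_def V_def)
  have shift: "(\<Sum>m\<in>?I. f m) = (\<Sum>k<N. f (Suc k))" for f :: "nat \<Rightarrow> complex"
    using sum.atLeast1_atMost_eq[of f N] by simp

  have "M_mat N a b c d x * V = V * U"
  proof (rule eq_matI)
    fix i j assume "i < dim_row (V * U)" "j < dim_col (V * U)"
    then have ij: "i < N" "j < N"
      by (simp_all add: V_def U_def)
    then have n: "Suc i \<in> ?I"
      by simp
    have "(M_mat N a b c d x * V) $$ (i, j) = (\<Sum>k<N. M (Suc i) (Suc k) * v (Suc k) j)"
      using ij by (simp add: M_mat_def V_def M_def scalar_prod_def atLeast0LessThan)
    also have "\<dots> = (lam N * poly (wilson_bracket a j) (w (Suc i)) - ?T (wilson_bracket a j) (x (Suc i)))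
        / (x (Suc i) * Q (Suc i))"
      using action[OF n, of "wilson_bracket a j"] ij unfolding shift v_def
      by (simp add: degree_wilson_bracket)
    also have "\<dots> = v (Suc i) j * (lam N - lam j) + (if j = 0 then 0 else v (Suc i) (j - 1) * R (j - 1))"
    proof (cases j)
      case 0
      then show ?thesis
        by (simp add: wilson_op_bracket_0 v_def lam_def wilson_eval_def)
    next
      case (Suc k)
      show ?thesis
        unfolding Suc wilson_op_bracket_Suc[OF x[OF n]] v_def lam_def[symmetric] R_def[symmetric] w_def
        by (simp add: add_divide_distrib[symmetric] algebra_simps)
    qed
    also have "\<dots> = (\<Sum>k<N. (if k = j then v (Suc i) k * (lam N - lam j) else 0)
        + (if Suc k = j then v (Suc i) k * R k else 0))"
    proof -
      have "(\<Sum>k<N. if Suc k = j then v (Suc i) k * R k else 0)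
          = (if j = 0 then 0 else v (Suc i) (j - 1) * R (j - 1))"
        using ij by (cases j) simp_all
      then show ?thesis
        using ij by (simp add: sum.distrib)
    qed
    also have "\<dots> = (\<Sum>k<N. v (Suc i) k * U $$ (k, j))"
      by (rule sum.cong) (use ij in \<open>auto simp: U_def\<close>)
    also have "\<dots> = (V * U) $$ (i, j)"
      using ij carrier by (simp add: V_def U_def scalar_prod_def atLeast0LessThan)
    finally show "(M_mat N a b c d x * V) $$ (i, j) = (V * U) $$ (i, j)" .
  qed (simp_all add: M_mat_def U_def V_def)

  \<comment> \<open>A kernel vector of \<open>V\<close> would give a polynomial of degree less than \<open>N\<close> with \<open>N\<close> zeros.\<close>
  moreover have "det V \<noteq> 0"
  proof
    assume "det V = 0"
    then obtain u where u: "u \<in> carrier_vec N" "u \<noteq> 0\<^sub>v N" "V *\<^sub>v u = 0\<^sub>v N"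
      using det_0_iff_vec_prod_zero_field[OF carrier(3)] by auto
    define p where "p = (\<Sum>j<N. Polynomial.smult (u $ j) (wilson_bracket a j))"
    have "p = 0"
    proof (rule poly_eqI_degree)
      show "degree p < card (w ` ?I)" "degree (0 :: complex poly) < card (w ` ?I)"
        unfolding card_image[OF inj] p_def using assms(1)
        by (auto simp: degree_wilson_bracket
            intro!: degree_sum_less le_less_trans[OF degree_smult_le])
    next
      fix t assume "t \<in> w ` ?I"
      then obtain n where n: "n \<in> ?I" "t = w n"
        by auto
      then obtain i where i: "n = Suc i" "i < N"
        by (cases n) auto
      have "0 = (V *\<^sub>v u) $ i"
        using u(3) i by simp
      also have "\<dots> = (\<Sum>j<N. v n j * u $ j)"
        using i u(1) by (auto simp: V_def scalar_prod_def atLeast0LessThan)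
      also have "\<dots> = poly p t / (x n * Q n)"
        by (simp add: p_def v_def poly_sum sum_divide_distrib n(2) mult.commute)
      finally show "poly p t = poly 0 t"
        using x[OF n(1)] Q[OF n(1)] by simp
    qed
    then have "u $ j = 0" if "j < N" for j
      using wilson_bracket_independent[of "\<lambda>j. u $ j" a N j] that unfolding p_def by simp
    then have "u = 0\<^sub>v N"
      using u(1) by (intro eq_vecI) auto
    then show False
      using u(2) by simp
  qed
  ultimately have "char_poly (M_mat N a b c d x) = char_poly U"
    by (intro char_poly_intertwine[OF carrier])
  also have "\<dots> = (\<Prod>t\<leftarrow>diag_mat U. [:- t, 1:])"
    by (rule char_poly_upper_triangular[OF carrier(2)]) (auto simp: U_def upper_triangular_def)
  finally have "eigenvalue_mset (M_mat N a b c d x) = mset (diag_mat U)"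
    unfolding eigenvalue_mset_def by (simp add: proots_linear_factors)
  also have "diag_mat U = map (\<lambda>k. lam N - lam k) [0..<N]"
    by (auto simp: diag_mat_def U_def)
  also have "mset \<dots> = image_mset (\<lambda>k. lam N - lam k) (mset_set {0..<N})"
    by simp
  also have "{0..<N} = (\<lambda>m. N - m) ` ?I"
  proof (intro equalityI subsetI)
    fix k assume "k \<in> {0..<N}"
    then show "k \<in> (\<lambda>m. N - m) ` ?I"
      by (intro image_eqI[of _ _ "N - k"]) auto
  qed auto
  also have "mset_set \<dots> = image_mset (\<lambda>m. N - m) (mset_set ?I)"
    by (rule image_mset_mset_set[symmetric]) (auto simp: inj_on_def)
  also have "image_mset (\<lambda>k. lam N - lam k) \<dots>
      = image_mset (\<lambda>m. of_nat m * (2 * of_nat N - of_nat m + alpha1 a b c d - 1)) (mset_set ?I)"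
    unfolding image_mset.compositionality
    by (rule image_mset_cong) (auto simp: lam_def wilson_eval_def of_nat_diff algebra_simps)
  finally show ?thesis .
qed

end
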